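(* Let $0<\alpha<1$ and let $p\ge 1$, $q\ge 1$ with $1/p+1/q\le 1+\alpha$, where moreover $p\ne 1$ and $q\ne 1$ in the case $1/p+1/q=1+\alpha$. If $f\in L^p([a,b],\mathbb{R})$ and $g\in L^q([a,b],\mathbb{R})$, then $$\int_a^b f(\tau)\cdot\left(\mathcal{I}^{\alpha}_{a+}g\right)^*(\tau)\,d\tau=\int_a^b\left(\mathcal{I}^{\alpha}_{a+}f\right)(\tau)\cdot g^*(\tau)\,d\tau .$$
   Context: For $f:[a,b]\to\mathbb{R}$ the dual function is $f^*(t)=f(b-t+a)$, $t\in[a,b]$. For $\alpha>0$ the left fractional integral of order $\alpha$ of $\varphi\in L^1([a,b],\mathbb{R})$ is $(\mathcal{I}^{\alpha}_{a+}\varphi)(t)=\frac{1}{\Gamma(\alpha)}\int_a^t\varphi(\tau)(t-\tau)^{\alpha-1}d\tau$, $t>a$. *)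

theory Defs
  imports "HOL-Analysis.Analysis"
begin

text \<open>Functions on \<open>[a,b]\<close> are represented by total functions on the reals; only their values
  on \<open>[a,b]\<close> enter the definitions below. Elements of \<open>L\<^sup>p\<close> are represented by functions rather
  than by almost-everywhere classes, and all integrals are Lebesgue integrals.\<close>

definition dual_fun :: "real \<Rightarrow> real \<Rightarrow> (real \<Rightarrow> real) \<Rightarrow> real \<Rightarrow> real" where
  "dual_fun a b f t = f (b - t + a)"

text \<open>Used only for finite exponents \<open>p \<ge> 1\<close>.\<close>

definition Lp_on :: "real \<Rightarrow> real set \<Rightarrow> (real \<Rightarrow> real) set" where
  "Lp_on p A = {f. set_borel_measurable lebesgue A f \<and>
                   set_integrable lebesgue A (\<lambda>x. \<bar>f x\<bar> powr p)}"

text \<open>At points \<open>t\<close> where the integrand is not Lebesgue integrable the value is the default \<open>0\<close>;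
  for \<open>\<phi>\<close> in \<open>L\<^sup>1\<close> these form a null set.\<close>

definition left_frac_integral :: "real \<Rightarrow> real \<Rightarrow> (real \<Rightarrow> real) \<Rightarrow> real \<Rightarrow> real" where
  "left_frac_integral \<alpha> a \<phi> t =
     1 / Gamma \<alpha> * (LINT \<tau>:{a..t}|lebesgue. \<phi> \<tau> * (t - \<tau>) powr (\<alpha> - 1))"

end

theory Submission
  imports Defs
begin

text \<open>After reflecting \<open>g\<close>, both sides are iterated integrals of \<open>f(x) g*(y) (y - x)^(\<alpha> - 1)\<close>
  over \<open>x < y\<close>, so by Fubini only absolute integrability is at stake (a
  Hardy-Littlewood-Sobolev bound). Replace \<open>\<bar>f\<bar>\<close>, \<open>\<bar>g*\<bar>\<close> by \<open>F, G \<ge> 1\<close> on the interval and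
  split the square into \<open>G(y)^q \<le> F(x)^p\<close> and its mirror image. With \<open>z = y - x\<close>, comparing
  \<open>G(y)\<close> with \<open>z^(-1/q)\<close> gives
  \<open>G(y) z^(\<alpha> - 1) \<le> min (G(y)) (z^(-1/q)) z^(\<alpha> - 1) + G(y)^q G(y)^(1 - q\<alpha>)\<close>.
  When \<open>q\<alpha> < 1\<close> and \<open>G(y) \<le> F(x)^(p/q)\<close>, the \<open>y\<close>-integral of the right-hand side is at most a
  constant times \<open>F(x)^(p - 1)\<close>. When \<open>q\<alpha> > 1\<close> the right-hand side is at most
  \<open>z^(\<alpha> - 1 - 1/q) + G(y)^q\<close>, which is integrable without splitting. The borderline \<open>q\<alpha> = 1\<close>
  is reduced to \<open>q\<alpha> < 1\<close> by lowering the exponents.\<close>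

section \<open>The truncated kernel and one-variable bounds\<close>

text \<open>Vanishing for \<open>z \<le> 0\<close> encodes the restriction to x < y in the double
  integral. The cut-off at \<open>L\<close> makes powers of z with exponent above -1 integrable over
  the half-line; it costs nothing for functions supported on an interval of length
  \<open>L\<close>.\<close>

definition trunc_kernel :: "real \<Rightarrow> real \<Rightarrow> real \<Rightarrow> real" where
  "trunc_kernel \<alpha> L z = (if 0 < z \<and> z \<le> L then z powr (\<alpha> - 1) else 0)"

lemma trunc_kernel_nonneg: "0 \<le> trunc_kernel \<alpha> L z"
  by (simp add: trunc_kernel_def)

lemma trunc_kernel_measurable [measurable]: "trunc_kernel \<alpha> L \<in> borel_measurable borel"
  unfolding trunc_kernel_def[abs_def] by measurable

text \<open>If \<open>h\<close> is at most z^(-1/q), the minimum is \<open>h\<close> and the first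
  term is already the left side. Otherwise z^(\<alpha> - 1) is a positive power of z^(-1/q), hence
  at most h^(q(1 - \<alpha>)), and the second term suffices.\<close>

lemma mult_powr_le_split:
  fixes h z q \<alpha> :: real
  assumes "0 < h" "0 < z" "0 < q" "\<alpha> < 1"
  shows "h * z powr (\<alpha> - 1)
    \<le> min h (z powr (- 1 / q)) * z powr (\<alpha> - 1) + h powr q * h powr (1 - q * \<alpha>)"
proof (cases "h \<le> z powr (- 1 / q)")
  case True
  then show ?thesis by (simp add: min_def)
next
  case False
  then have "(z powr (- 1 / q)) powr (q * (1 - \<alpha>)) \<le> h powr (q * (1 - \<alpha>))"
    using assms by (intro powr_mono2 mult_nonneg_nonneg) auto
  also have "(z powr (- 1 / q)) powr (q * (1 - \<alpha>)) = z powr (\<alpha> - 1)"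
    using assms by (simp add: powr_powr)
  finally have "h * z powr (\<alpha> - 1) \<le> h powr 1 * h powr (q * (1 - \<alpha>))"
    using assms by simp
  also have "\<dots> = h powr q * h powr (1 - q * \<alpha>)"
    by (simp only: powr_add[symmetric]) (simp add: algebra_simps)
  also have "\<dots> \<le> min h (z powr (- 1 / q)) * z powr (\<alpha> - 1) + h powr q * h powr (1 - q * \<alpha>)"
    using assms by simp
  finally show ?thesis .
qed

text \<open>Near 0 the integrand is at most M z^(\<alpha> - 1), integrable since \<alpha> > 0; far
  out it is at most z^(\<alpha> - 1 - 1/q), integrable at infinity since \<alpha> < 1/q. Scaling
  explains the power of \<open>M\<close>.\<close>

lemma nn_integral_min_powr_bound:
  fixes M q \<alpha> :: real
  assumes "0 < M" "0 < q" "0 < \<alpha>" "q * \<alpha> < 1"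
  shows "(\<integral>\<^sup>+z. ennreal (if 0 < z then min M (z powr (- 1 / q)) * z powr (\<alpha> - 1) else 0) \<partial>lborel)
    \<le> ennreal ((1 / \<alpha> + 1 / (1 / q - \<alpha>)) * M powr (1 - q * \<alpha>))"
proof -
  \<comment> \<open>This is the point where z^(-1/q) equals \<open>M\<close>. The pointwise bound
    holds for any positive split point; this one makes both pieces multiples of the same power M^(1
    - q\<alpha>).\<close>
  define R where "R = M powr (- q)"
  have R: "0 < R" using assms by (simp add: R_def)
  have qa: "\<alpha> < 1 / q" using assms by (simp add: field_simps)
  define e where "e = \<alpha> - 1 - 1 / q"
  have e: "e < -1" using qa by (simp add: e_def)
  have I1: "(\<integral>\<^sup>+z. ennreal (indicator {0..R} z * z powr (\<alpha> - 1)) \<partial>lborel)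
      = ennreal (R powr \<alpha> / \<alpha>)"
    using nn_integral_has_integral_lebesgue[OF _ has_integral_powr_from_0[of "\<alpha> - 1" R]] assms R
    by simp
  have I2: "(\<integral>\<^sup>+z. ennreal (indicator {R..} z * z powr e) \<partial>lborel)
      = ennreal (- (R powr (e + 1)) / (e + 1))"
    using nn_integral_has_integral_lebesgue[OF _ has_integral_powr_to_inf[of e R]] e R
    by simp
  have "(\<integral>\<^sup>+z. ennreal (if 0 < z then min M (z powr (- 1 / q)) * z powr (\<alpha> - 1) else 0) \<partial>lborel)
     \<le> (\<integral>\<^sup>+z. ennreal M * ennreal (indicator {0..R} z * z powr (\<alpha> - 1))
             + ennreal (indicator {R..} z * z powr e) \<partial>lborel)"
  proof (rule nn_integral_mono)
    fix z :: real
    have "z powr e = z powr (- 1 / q) * z powr (\<alpha> - 1)"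
      by (simp flip: powr_add add: e_def)
    then have "(if 0 < z then min M (z powr (- 1 / q)) * z powr (\<alpha> - 1) else 0)
      \<le> M * (indicator {0..R} z * z powr (\<alpha> - 1)) + indicator {R..} z * z powr e"
      using assms by (auto simp: indicator_def intro!: mult_right_mono add_increasing2)
    then show "ennreal (if 0 < z then min M (z powr (- 1 / q)) * z powr (\<alpha> - 1) else 0)
      \<le> ennreal M * ennreal (indicator {0..R} z * z powr (\<alpha> - 1))
        + ennreal (indicator {R..} z * z powr e)"
      using assms by (simp flip: ennreal_mult ennreal_plus) 
  qed
  also have "\<dots> = ennreal M * ennreal (R powr \<alpha> / \<alpha>) + ennreal (- (R powr (e + 1)) / (e + 1))"
    by (simp add: nn_integral_add nn_integral_cmult I1 I2)
  also have "\<dots> = ennreal (M * (R powr \<alpha> / \<alpha>) + (- (R powr (e + 1)) / (e + 1)))"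
    using assms e by (subst ennreal_plus) (auto simp: divide_nonneg_neg simp flip: ennreal_mult)
  also have "R powr (e + 1) = M powr (1 - q * \<alpha>)"
    using assms by (simp add: R_def powr_powr e_def algebra_simps)
  also have "M * (R powr \<alpha> / \<alpha>) = M powr (1 - q * \<alpha>) / \<alpha>"
  proof -
    have "M * R powr \<alpha> = M powr 1 * M powr (- q * \<alpha>)"
      using assms by (simp add: R_def powr_powr)
    also have "\<dots> = M powr (1 - q * \<alpha>)"
      by (simp only: powr_add[symmetric]) simp
    finally show ?thesis by simp
  qed
  also have "M powr (1 - q * \<alpha>) / \<alpha> + - (M powr (1 - q * \<alpha>)) / (e + 1)
      = (1 / \<alpha> + 1 / (1 / q - \<alpha>)) * M powr (1 - q * \<alpha>)"
  proof -
    have "e + 1 = - (1 / q - \<alpha>)" by (simp add: e_def)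
    then show ?thesis by (simp only: minus_divide_divide) (simp add: algebra_simps)
  qed
  finally show ?thesis .
qed

section \<open>Double integral estimates for q\<alpha> < 1 and for q\<alpha> > 1\<close>

text \<open>For fixed x the inner integral is at most a constant times F(x)^p, so the outer one is
  finite. The sign \<open>c\<close> lets the same estimate serve for the mirror-image region with
  \<open>F\<close> and \<open>G\<close> interchanged. The exponents are only assumed positive
  because they may have been lowered below 1 before the estimate is applied.\<close>

lemma nn_integral_trunc_kernel_region_finite:
  fixes F G :: "real \<Rightarrow> real"
  assumes [measurable]: "F \<in> borel_measurable lebesgue" "G \<in> borel_measurable lebesgue"
    and F: "\<And>x. F x = 0 \<or> 1 \<le> F x" and G: "\<And>x. 0 \<le> G x"
    and pos: "0 < p" "0 < q" "0 < \<alpha>" "\<alpha> < 1" "q * \<alpha> < 1"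
    and crit: "1 / p + 1 / q \<le> 1 + \<alpha>"
    and Fp: "(\<integral>\<^sup>+x. ennreal (F x powr p) \<partial>lebesgue) < \<infinity>"
    and Gq: "(\<integral>\<^sup>+x. ennreal (G x powr q) \<partial>lebesgue) < \<infinity>"
    and c: "\<bar>c\<bar> = (1::real)"
  shows "(\<integral>\<^sup>+x. \<integral>\<^sup>+y. ennreal (if G y powr q \<le> F x powr p
            then F x * G y * trunc_kernel \<alpha> L (c * (y - x)) else 0) \<partial>lebesgue \<partial>lebesgue) < \<infinity>"
proof -
  define C where "C = 1 / \<alpha> + 1 / (1 / q - \<alpha>)"
  have "\<alpha> < 1 / q" using pos by (simp add: field_simps)
  then have C: "0 \<le> C" using pos by (simp add: C_def)
  define I where "I = (\<integral>\<^sup>+x. ennreal (G x powr q) \<partial>lebesgue)"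
  have inner: "(\<integral>\<^sup>+y. ennreal (if G y powr q \<le> F x powr p
        then F x * G y * trunc_kernel \<alpha> L (c * (y - x)) else 0) \<partial>lebesgue)
      \<le> (ennreal C + I) * ennreal (F x powr p)" for x
  proof (cases "F x = 0")
    case True
    have "(\<lambda>y. ennreal (if G y powr q \<le> F x powr p
        then F x * G y * trunc_kernel \<alpha> L (c * (y - x)) else 0)) = (\<lambda>y. 0)"
      using True by (auto simp: fun_eq_iff)
    then show ?thesis by simp
  next
    case False
    with F[of x] have Fx: "1 \<le> F x" by auto
    \<comment> \<open>For this x, \<open>M\<close> is the upper bound that the region imposes on
      \<open>G y\<close>.\<close>
    define M where "M = F x powr (p / q)"
    have M: "0 < M" using Fx by (simp add: M_def)
    define \<phi> where "\<phi> z = (if 0 < z then min M (z powr (- 1 / q)) * z powr (\<alpha> - 1) else 0)" for z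
    have \<phi>_meas [measurable]: "\<phi> \<in> borel_measurable borel"
      unfolding \<phi>_def[abs_def] by measurable
    have \<phi>_nn: "0 \<le> \<phi> z" for z using M by (simp add: \<phi>_def)
    \<comment> \<open>The exponent condition multiplied by \<open>p\<close>. Together with
      \<open>F x\<close> being at least 1 it yields \<open>FM\<close>, the only place where the
      condition enters.\<close>
    have "1 / p * p + 1 / q * p \<le> (1 + \<alpha>) * p"
      using mult_right_mono[OF crit, of p] pos by (simp add: algebra_simps)
    then have expo: "1 + p / q - p * \<alpha> \<le> p" using pos by (simp add: algebra_simps)
    have FM: "F x * M powr (1 - q * \<alpha>) \<le> F x powr p"
    proof -
      have "F x * M powr (1 - q * \<alpha>) = F x powr 1 * F x powr (p / q - p * \<alpha>)"
        using Fx pos by (simp add: M_def powr_powr algebra_simps)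
      also have "\<dots> = F x powr (1 + p / q - p * \<alpha>)"
        by (simp only: powr_add[symmetric] add_diff_eq)
      also have "\<dots> \<le> F x powr p" using Fx expo by (intro powr_mono)
      finally show ?thesis .
    qed
    have "(\<integral>\<^sup>+y. ennreal (if G y powr q \<le> F x powr p
        then F x * G y * trunc_kernel \<alpha> L (c * (y - x)) else 0) \<partial>lebesgue)
      \<le> (\<integral>\<^sup>+y. ennreal (F x) * ennreal (\<phi> (- c * x + c * y))
           + ennreal (F x powr p) * ennreal (G y powr q) \<partial>lebesgue)"
    proof (rule nn_integral_mono)
      fix y
      define z where "z = - c * x + c * y"
      have z: "c * (y - x) = z" by (simp add: z_def algebra_simps)
      have "(if G y powr q \<le> F x powr p then F x * G y * trunc_kernel \<alpha> L z else 0)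
        \<le> F x * \<phi> z + F x powr p * G y powr q"
      proof (cases "G y powr q \<le> F x powr p \<and> 0 < G y \<and> 0 < z \<and> z \<le> L")
        case True
        have "(G y powr q) powr (1 / q) \<le> (F x powr p) powr (1 / q)"
          using True pos by (intro powr_mono2) auto
        then have GM: "G y \<le> M" using True pos by (simp add: powr_powr M_def)
        \<comment> \<open>Since 1 - q\<alpha> is positive, the leftover power of \<open>G y\<close>
          is monotone and the region bound applies to it. The factor \<open>G y powr q\<close> is
          kept, because it is what integrates to \<open>I\<close>.\<close>
        have GM': "G y powr (1 - q * \<alpha>) \<le> M powr (1 - q * \<alpha>)"
          using True GM pos by (intro powr_mono2) auto
        have "G y * z powr (\<alpha> - 1) \<le> min (G y) (z powr (- 1 / q)) * z powr (\<alpha> - 1)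
            + G y powr q * G y powr (1 - q * \<alpha>)"
          using True pos by (intro mult_powr_le_split) auto
        also have "\<dots> \<le> min M (z powr (- 1 / q)) * z powr (\<alpha> - 1)
            + G y powr q * M powr (1 - q * \<alpha>)"
          using GM GM' by (intro add_mono mult_right_mono mult_left_mono min.mono) auto
        finally have "F x * (G y * z powr (\<alpha> - 1)) \<le> F x * (\<phi> z + G y powr q * M powr (1 - q * \<alpha>))"
          using Fx True by (intro mult_left_mono) (auto simp: \<phi>_def)
        also have "\<dots> = F x * \<phi> z + (F x * M powr (1 - q * \<alpha>)) * G y powr q"
          by (simp add: algebra_simps)
        also have "\<dots> \<le> F x * \<phi> z + F x powr p * G y powr q"
          using FM by (intro add_left_mono mult_right_mono) auto
        finally show ?thesis using True by (simp add: trunc_kernel_def mult.assoc)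
      next
        case False
        have "0 \<le> F x * \<phi> z + F x powr p * G y powr q"
          using Fx \<phi>_nn by simp
        moreover have "(if G y powr q \<le> F x powr p then F x * G y * trunc_kernel \<alpha> L z else 0) = 0"
          using False G[of y] by (auto simp: trunc_kernel_def)
        ultimately show ?thesis by simp
      qed
      then show "ennreal (if G y powr q \<le> F x powr p
          then F x * G y * trunc_kernel \<alpha> L (c * (y - x)) else 0)
        \<le> ennreal (F x) * ennreal (\<phi> (- c * x + c * y)) + ennreal (F x powr p) * ennreal (G y powr q)"
        unfolding z z_def[symmetric] using Fx \<phi>_nn by (simp flip: ennreal_mult ennreal_plus)
    qed
    also have "\<dots> = ennreal (F x) * (\<integral>\<^sup>+y. ennreal (\<phi> (- c * x + c * y)) \<partial>lebesgue)
        + ennreal (F x powr p) * I"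
    proof -
      have [measurable]: "(\<lambda>y. ennreal (\<phi> (c * y - c * x))) \<in> borel_measurable lebesgue"
        by (rule measurable_completion) measurable
      show ?thesis by (simp add: nn_integral_add nn_integral_cmult I_def)
    qed
    also have "(\<integral>\<^sup>+y. ennreal (\<phi> (- c * x + c * y)) \<partial>lebesgue) = (\<integral>\<^sup>+z. ennreal (\<phi> z) \<partial>lborel)"
      using nn_integral_real_affine[of "\<lambda>z. ennreal (\<phi> z)" c "- c * x"] c
      by (auto simp: nn_integral_completion)
    also have "ennreal (F x) * (\<integral>\<^sup>+z. ennreal (\<phi> z) \<partial>lborel) + ennreal (F x powr p) * I
        \<le> ennreal C * ennreal (F x powr p) + ennreal (F x powr p) * I"
    proof (rule add_right_mono)
      have "(\<integral>\<^sup>+z. ennreal (\<phi> z) \<partial>lborel) \<le> ennreal (C * M powr (1 - q * \<alpha>))"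
        unfolding \<phi>_def C_def using M pos by (intro nn_integral_min_powr_bound)
      then have "ennreal (F x) * (\<integral>\<^sup>+z. ennreal (\<phi> z) \<partial>lborel)
          \<le> ennreal (F x) * ennreal (C * M powr (1 - q * \<alpha>))"
        by (rule mult_left_mono) simp
      also have "\<dots> = ennreal (C * (F x * M powr (1 - q * \<alpha>)))"
        using Fx C by (simp flip: ennreal_mult add: mult_ac)
      also have "\<dots> \<le> ennreal (C * F x powr p)"
        using FM C by (intro ennreal_leI mult_left_mono)
      finally show "ennreal (F x) * (\<integral>\<^sup>+z. ennreal (\<phi> z) \<partial>lborel) \<le> ennreal C * ennreal (F x powr p)"
        using C by (simp flip: ennreal_mult)
    qed
    finally show ?thesis
      by (simp add: algebra_simps)
  qed
  have "(\<integral>\<^sup>+x. \<integral>\<^sup>+y. ennreal (if G y powr q \<le> F x powr p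
            then F x * G y * trunc_kernel \<alpha> L (c * (y - x)) else 0) \<partial>lebesgue \<partial>lebesgue)
     \<le> (\<integral>\<^sup>+x. (ennreal C + I) * ennreal (F x powr p) \<partial>lebesgue)"
    by (intro nn_integral_mono inner)
  also have "\<dots> = (ennreal C + I) * (\<integral>\<^sup>+x. ennreal (F x powr p) \<partial>lebesgue)"
    by (simp add: nn_integral_cmult)
  also have "\<dots> < \<infinity>"
    using Fp Gq by (simp add: I_def ennreal_mult_less_top)
  finally show ?thesis .
qed

text \<open>Here \<alpha> - 1 - 1/q exceeds -1, so this power of z is integrable on the bounded
  range left by the cut-off, and G^(1 - q\<alpha>) is at most 1 where G is at least 1. The inner
  integral is thus at most a constant times F(x), uniformly in x, and integrability of
  \<open>F\<close> is enough.\<close>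

lemma nn_integral_trunc_kernel_finite_supercritical:
  fixes F G :: "real \<Rightarrow> real"
  assumes [measurable]: "F \<in> borel_measurable lebesgue" "G \<in> borel_measurable lebesgue"
    and F: "\<And>x. 0 \<le> F x" and G: "\<And>x. G x = 0 \<or> 1 \<le> G x"
    and pos: "0 < q" "\<alpha> < 1" "1 < q * \<alpha>" "0 < L"
    and F1: "(\<integral>\<^sup>+x. ennreal (F x) \<partial>lebesgue) < \<infinity>"
    and Gq: "(\<integral>\<^sup>+x. ennreal (G x powr q) \<partial>lebesgue) < \<infinity>"
    and c: "\<bar>c\<bar> = (1::real)"
  shows "(\<integral>\<^sup>+x. \<integral>\<^sup>+y. ennreal (F x * G y * trunc_kernel \<alpha> L (c * (y - x))) \<partial>lebesgue \<partial>lebesgue) < \<infinity>"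
proof -
  define I where "I = (\<integral>\<^sup>+x. ennreal (G x powr q) \<partial>lebesgue)"
  have qa: "1 / q < \<alpha>" using pos by (simp add: field_simps)
  define e where "e = \<alpha> - 1 - 1 / q"
  have e: "-1 < e" using qa by (simp add: e_def)
  define \<phi> where "\<phi> z = indicator {0..L} z * z powr e" for z :: real
  have \<phi>_meas [measurable]: "\<phi> \<in> borel_measurable borel"
    unfolding \<phi>_def[abs_def] by measurable
  have \<phi>_nn: "0 \<le> \<phi> z" for z by (simp add: \<phi>_def)
  define K where "K = L powr (e + 1) / (e + 1)"
  have I1: "(\<integral>\<^sup>+z. ennreal (\<phi> z) \<partial>lborel) = ennreal K"
    using nn_integral_has_integral_lebesgue[OF _ has_integral_powr_from_0[of e L]] e pos
    by (simp add: \<phi>_def K_def)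
  have inner: "(\<integral>\<^sup>+y. ennreal (F x * G y * trunc_kernel \<alpha> L (c * (y - x))) \<partial>lebesgue)
      \<le> ennreal (F x) * (ennreal K + I)" for x
  proof -
    have "(\<integral>\<^sup>+y. ennreal (F x * G y * trunc_kernel \<alpha> L (c * (y - x))) \<partial>lebesgue)
      \<le> (\<integral>\<^sup>+y. ennreal (F x) * (ennreal (\<phi> (- c * x + c * y)) + ennreal (G y powr q)) \<partial>lebesgue)"
    proof (rule nn_integral_mono)
      fix y
      define z where "z = - c * x + c * y"
      have z: "c * (y - x) = z" by (simp add: z_def algebra_simps)
      have "G y * trunc_kernel \<alpha> L z \<le> \<phi> z + G y powr q"
      proof (cases "1 \<le> G y \<and> 0 < z \<and> z \<le> L")
        case True
        have "G y * z powr (\<alpha> - 1) \<le> min (G y) (z powr (- 1 / q)) * z powr (\<alpha> - 1)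
            + G y powr q * G y powr (1 - q * \<alpha>)"
          using True pos by (intro mult_powr_le_split) auto
        also have "\<dots> \<le> z powr (- 1 / q) * z powr (\<alpha> - 1) + G y powr q * G y powr 0"
          using True pos by (intro add_mono mult_right_mono mult_left_mono powr_mono) auto
        also have "z powr (- 1 / q) * z powr (\<alpha> - 1) = \<phi> z"
          using True by (simp flip: powr_add add: \<phi>_def e_def)
        finally show ?thesis using True by (simp add: trunc_kernel_def)
      next
        case False
        then have "G y * trunc_kernel \<alpha> L z = 0"
          using G[of y] by (auto simp: trunc_kernel_def)
        then show ?thesis using \<phi>_nn[of z] by (simp only: add_nonneg_nonneg powr_ge_zero)
      qed
      then have "F x * (G y * trunc_kernel \<alpha> L z) \<le> F x * (\<phi> z + G y powr q)"
        using F by (intro mult_left_mono)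
      then show "ennreal (F x * G y * trunc_kernel \<alpha> L (c * (y - x)))
        \<le> ennreal (F x) * (ennreal (\<phi> (- c * x + c * y)) + ennreal (G y powr q))"
        unfolding z z_def[symmetric] using F \<phi>_nn
          by (simp flip: ennreal_mult ennreal_plus add: mult.assoc)
    qed
    also have "\<dots> = ennreal (F x) * ((\<integral>\<^sup>+y. ennreal (\<phi> (- c * x + c * y)) \<partial>lebesgue) + I)"
    proof -
      have [measurable]: "(\<lambda>y. ennreal (\<phi> (c * y - c * x))) \<in> borel_measurable lebesgue"
        by (rule measurable_completion) measurable
      show ?thesis by (simp add: nn_integral_add nn_integral_cmult I_def)
    qed
    also have "(\<integral>\<^sup>+y. ennreal (\<phi> (- c * x + c * y)) \<partial>lebesgue) = ennreal K"
      using nn_integral_real_affine[of "\<lambda>z. ennreal (\<phi> z)" c "- c * x"] c I1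
      by (auto simp: nn_integral_completion)
    finally show ?thesis .
  qed
  have "(\<integral>\<^sup>+x. \<integral>\<^sup>+y. ennreal (F x * G y * trunc_kernel \<alpha> L (c * (y - x))) \<partial>lebesgue \<partial>lebesgue)
     \<le> (\<integral>\<^sup>+x. ennreal (F x) * (ennreal K + I) \<partial>lebesgue)"
    by (intro nn_integral_mono inner)
  also have "\<dots> = (\<integral>\<^sup>+x. ennreal (F x) \<partial>lebesgue) * (ennreal K + I)"
    by (simp add: nn_integral_multc)
  also have "\<dots> < \<infinity>"
    using F1 Gq by (simp add: I_def ennreal_mult_less_top)
  finally show ?thesis .
qed

section \<open>Fubini on the product of two Lebesgue measures\<close>

text \<open>Closed balls of integer radius cover the space and have finite measure. The functions at
  hand are only Lebesgue measurable, so Fubini is used on the product of two completed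
  measures.\<close>

lemma sigma_finite_lebesgue: "sigma_finite_measure (lebesgue :: 'a::euclidean_space measure)"
proof
  show "\<exists>A::'a set set. countable A \<and> A \<subseteq> sets lebesgue \<and> \<Union> A = space lebesgue
      \<and> (\<forall>a\<in>A. emeasure lebesgue a \<noteq> \<infinity>)"
  proof (intro exI conjI)
    show "\<Union> (range (\<lambda>n. cball (0::'a) (real n))) = space lebesgue"
      using real_arch_simple by auto
    show "\<forall>a\<in>range (\<lambda>n. cball (0::'a) (real n)). emeasure lebesgue a \<noteq> \<infinity>"
      using emeasure_bounded_finite[OF bounded_cball] by (auto simp: less_top)
  qed auto
qed

interpretation lebesgue_pair: pair_sigma_finite
  "lebesgue :: 'a::euclidean_space measure" "lebesgue :: 'b::euclidean_space measure"
  by (intro pair_sigma_finite.intro sigma_finite_lebesgue)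

text \<open>Borel sets are Lebesgue measurable, so the projections remain measurable when read as
  Borel-valued maps. This gives joint measurability of a Borel kernel applied to y - x.\<close>

lemma fst_snd_borel_measurable_lebesgue_pair [measurable]:
  "fst \<in> borel_measurable (lebesgue \<Otimes>\<^sub>M (lebesgue :: real measure))"
  "snd \<in> borel_measurable ((lebesgue :: real measure) \<Otimes>\<^sub>M lebesgue)"
proof -
  have "(\<lambda>x. x) \<in> borel_measurable lebesgue" by (rule measurable_completion) simp
  then show "fst \<in> borel_measurable (lebesgue \<Otimes>\<^sub>M (lebesgue :: real measure))"
    "snd \<in> borel_measurable ((lebesgue :: real measure) \<Otimes>\<^sub>M lebesgue)"
    by (auto intro: measurable_compose[OF measurable_fst] measurable_compose[OF measurable_snd])
qed

section \<open>Finiteness of the double integral for all admissible exponents\<close>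

text \<open>Powers of a number at least 1 increase with the exponent, and \<open>0 powr r\<close> is
  0 for every \<open>r\<close>, so the comparison is pointwise. It allows exponents to be lowered
  without any assumption on the measure.\<close>

lemma nn_integral_powr_finite_mono:
  fixes F :: "real \<Rightarrow> real"
  assumes "\<And>x. F x = 0 \<or> 1 \<le> F x" "r \<le> p"
    and "(\<integral>\<^sup>+x. ennreal (F x powr p) \<partial>M) < \<infinity>"
  shows "(\<integral>\<^sup>+x. ennreal (F x powr r) \<partial>M) < \<infinity>"
proof -
  have "F x powr r \<le> F x powr p" for x
    using assms(1)[of x] assms(2) by (auto intro: powr_mono)
  then have "(\<integral>\<^sup>+x. ennreal (F x powr r) \<partial>M) \<le> (\<integral>\<^sup>+x. ennreal (F x powr p) \<partial>M)"
    by (intro nn_integral_mono ennreal_leI)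
  then show ?thesis using assms(3) by (rule le_less_trans)
qed

text \<open>If 1/q or 1/p lies below \<alpha>, the estimate without a region applies, in the second
  case after exchanging the variables. Otherwise the region estimate is applied twice, with
  exponents adjusted so that both products with \<alpha> are strictly below 1.\<close>

lemma nn_integral_trunc_kernel_finite:
  fixes F G :: "real \<Rightarrow> real"
  assumes [measurable]: "F \<in> borel_measurable lebesgue" "G \<in> borel_measurable lebesgue"
    and F: "\<And>x. F x = 0 \<or> 1 \<le> F x" and G: "\<And>x. G x = 0 \<or> 1 \<le> G x"
    and pos: "0 < \<alpha>" "\<alpha> < 1" "1 \<le> p" "1 \<le> q" "0 < L"
    and le: "1 / p + 1 / q \<le> 1 + \<alpha>"
    and crit: "1 / p + 1 / q = 1 + \<alpha> \<longrightarrow> p \<noteq> 1 \<and> q \<noteq> 1"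
    and Fp: "(\<integral>\<^sup>+x. ennreal (F x powr p) \<partial>lebesgue) < \<infinity>"
    and Gq: "(\<integral>\<^sup>+x. ennreal (G x powr q) \<partial>lebesgue) < \<infinity>"
  shows "(\<integral>\<^sup>+x. \<integral>\<^sup>+y. ennreal (F x * G y * trunc_kernel \<alpha> L (y - x)) \<partial>lebesgue \<partial>lebesgue) < \<infinity>"
proof -
  have F0: "0 \<le> F x" and G0: "0 \<le> G x" for x using F[of x] G[of x] by auto
  consider "1 / q < \<alpha>" | "1 / p < \<alpha>" | "\<alpha> \<le> 1 / q" "\<alpha> \<le> 1 / p" by linarith
  then show ?thesis
  proof cases
    case 1
    have "(\<integral>\<^sup>+x. ennreal (F x) \<partial>lebesgue) < \<infinity>"
      using nn_integral_powr_finite_mono[OF F pos(3) Fp] F0 by simp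
    then show ?thesis
      using nn_integral_trunc_kernel_finite_supercritical[of F G q \<alpha> L 1] F0 G pos Gq 1
      by (simp add: field_simps)
  next
    case 2
    have "(\<integral>\<^sup>+x. ennreal (G x) \<partial>lebesgue) < \<infinity>"
      using nn_integral_powr_finite_mono[OF G pos(4) Gq] G0 by simp
    \<comment> \<open>The roles of the two functions are exchanged; the sign -1 turns the kernel
      argument back into y - x, and Tonelli restores the order of integration.\<close>
    then have "(\<integral>\<^sup>+y. \<integral>\<^sup>+x. ennreal (G y * F x * trunc_kernel \<alpha> L (-1 * (x - y))) \<partial>lebesgue \<partial>lebesgue) < \<infinity>"
      using G0 F pos Fp 2
      by (intro nn_integral_trunc_kernel_finite_supercritical[of G F p \<alpha> L "-1"]) (auto simp: field_simps)
    also have "(\<integral>\<^sup>+y. \<integral>\<^sup>+x. ennreal (G y * F x * trunc_kernel \<alpha> L (-1 * (x - y))) \<partial>lebesgue \<partial>lebesgue)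
      = (\<integral>\<^sup>+x. \<integral>\<^sup>+y. ennreal (G y * F x * trunc_kernel \<alpha> L (-1 * (x - y))) \<partial>lebesgue \<partial>lebesgue)"
      by (rule lebesgue_pair.Fubini') (simp add: split_beta')
    finally show ?thesis by (simp add: mult_ac)
  next
    case 3
    obtain p' q' where pq': "0 < p'" "0 < q'" "p' \<le> p" "q' \<le> q" "p' * \<alpha> < 1" "q' * \<alpha> < 1"
        "1 / p' + 1 / q' \<le> 1 + \<alpha>"
    proof (cases "1 / p + 1 / q = 1 + \<alpha>")
      case True
      \<comment> \<open>This is where the excluded endpoints matter: with equality, 1/p < 1 forces
        1/q > \<alpha> and vice versa, so the original exponents already work.\<close>
      then have "1 < p" "1 < q" using crit pos by auto
      then have "1 / p < 1" "1 / q < 1" by auto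
      then have "\<alpha> < 1 / p" "\<alpha> < 1 / q" using True by linarith+
      then show thesis using True pos by (intro that[of p q]) (auto simp: field_simps)
    next
      case False
      \<comment> \<open>both reciprocals are raised by half the slack, so the new exponents may drop below 1\<close>
      define d where "d = (1 + \<alpha> - 1 / p - 1 / q) / 2"
      have d: "0 < d" using False le by (simp add: d_def)
      have "0 < 1 / p" "0 < 1 / q" using pos by auto
      then have u: "0 < 1 / p + d" "0 < 1 / q + d" using d
        by (auto intro: add_pos_pos simp del: zero_less_divide_1_iff)
      show thesis
      proof (rule that[of "1 / (1 / p + d)" "1 / (1 / q + d)"])
        show "1 / (1 / p + d) \<le> p" "1 / (1 / q + d) \<le> q"
          using le_imp_inverse_le[of "1 / p" "1 / p + d"] le_imp_inverse_le[of "1 / q" "1 / q + d"]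
            \<open>0 < 1 / p\<close> \<open>0 < 1 / q\<close> d by (simp_all add: inverse_eq_divide)
        show "1 / (1 / p + d) * \<alpha> < 1" "1 / (1 / q + d) * \<alpha> < 1"
          using u 3 d by (simp_all add: pos_divide_less_eq)
        show "1 / (1 / (1 / p + d)) + 1 / (1 / (1 / q + d)) \<le> 1 + \<alpha>"
          by (simp add: d_def)
      qed (use u in auto)
    qed
    have Fp': "(\<integral>\<^sup>+x. ennreal (F x powr p') \<partial>lebesgue) < \<infinity>"
      using nn_integral_powr_finite_mono[OF F pq'(3) Fp] .
    have Gq': "(\<integral>\<^sup>+x. ennreal (G x powr q') \<partial>lebesgue) < \<infinity>"
      using nn_integral_powr_finite_mono[OF G pq'(4) Gq] .
    define H1 where "H1 x y = ennreal (if G y powr q' \<le> F x powr p'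
            then F x * G y * trunc_kernel \<alpha> L (1 * (y - x)) else 0)" for x y
    define H2 where "H2 x y = ennreal (if F x powr p' \<le> G y powr q'
            then G y * F x * trunc_kernel \<alpha> L (-1 * (x - y)) else 0)" for x y
    have [measurable]: "case_prod H1 \<in> borel_measurable (lebesgue \<Otimes>\<^sub>M lebesgue)"
      "case_prod H2 \<in> borel_measurable (lebesgue \<Otimes>\<^sub>M lebesgue)"
      unfolding H1_def H2_def split_beta' by measurable
    have A: "(\<integral>\<^sup>+x. \<integral>\<^sup>+y. H1 x y \<partial>lebesgue \<partial>lebesgue) < \<infinity>"
      unfolding H1_def using F G0 pos pq' Fp' Gq'
      by (intro nn_integral_trunc_kernel_region_finite) auto
    have "(\<integral>\<^sup>+y. \<integral>\<^sup>+x. H2 x y \<partial>lebesgue \<partial>lebesgue) < \<infinity>"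
      unfolding H2_def using F0 G pos pq' Fp' Gq'
      by (intro nn_integral_trunc_kernel_region_finite) auto
    also have "(\<integral>\<^sup>+y. \<integral>\<^sup>+x. H2 x y \<partial>lebesgue \<partial>lebesgue) = (\<integral>\<^sup>+x. \<integral>\<^sup>+y. H2 x y \<partial>lebesgue \<partial>lebesgue)"
      by (rule lebesgue_pair.Fubini') simp
    finally have B: "(\<integral>\<^sup>+x. \<integral>\<^sup>+y. H2 x y \<partial>lebesgue \<partial>lebesgue) < \<infinity>" .
    \<comment> \<open>Each pair (x, y) lies in at least one of the two regions. They overlap where
      the two powers agree, hence only an inequality.\<close>
    have "(\<integral>\<^sup>+x. \<integral>\<^sup>+y. ennreal (F x * G y * trunc_kernel \<alpha> L (y - x)) \<partial>lebesgue \<partial>lebesgue)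
      \<le> (\<integral>\<^sup>+x. \<integral>\<^sup>+y. H1 x y + H2 x y \<partial>lebesgue \<partial>lebesgue)"
      by (intro nn_integral_mono) (auto simp: H1_def H2_def mult_ac)
    also have "\<dots> = (\<integral>\<^sup>+x. (\<integral>\<^sup>+y. H1 x y \<partial>lebesgue) + (\<integral>\<^sup>+y. H2 x y \<partial>lebesgue) \<partial>lebesgue)"
      by (intro nn_integral_cong nn_integral_add) measurable
    also have "\<dots> = (\<integral>\<^sup>+x. \<integral>\<^sup>+y. H1 x y \<partial>lebesgue \<partial>lebesgue) + (\<integral>\<^sup>+x. \<integral>\<^sup>+y. H2 x y \<partial>lebesgue \<partial>lebesgue)"
      by (intro nn_integral_add) measurable
    also have "\<dots> < \<infinity>" using A B by simp
    finally show ?thesis .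
  qed
qed

section \<open>From p-integrable functions to the duality formula\<close>

text \<open>On the interval max(1, |f|)^p is at most |f|^p + 1, and the interval has finite length.
  This provides majorants whose values are 0 or at least 1.\<close>

lemma Lp_on_powr_max_finite:
  assumes "f \<in> Lp_on p {a..b}" "0 < p"
  shows "(\<integral>\<^sup>+x. ennreal ((indicator {a..b} x * max 1 \<bar>f x\<bar>) powr p) \<partial>lebesgue) < \<infinity>"
proof -
  have "integrable lebesgue (\<lambda>x. indicator {a..b} x * \<bar>f x\<bar> powr p)"
    using assms by (simp add: Lp_on_def set_integrable_def)
  moreover have "integrable lebesgue (indicator {a..b} :: real \<Rightarrow> real)"
    using lmeasurable_cbox[of a b] by (intro integrable_real_indicator) (auto simp: fmeasurable_def)
  ultimately have I: "integrable lebesgue (\<lambda>x. indicator {a..b} x * \<bar>f x\<bar> powr p + indicator {a..b} x)"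
    by (rule Bochner_Integration.integrable_add)
  have "(\<integral>\<^sup>+x. ennreal ((indicator {a..b} x * max 1 \<bar>f x\<bar>) powr p) \<partial>lebesgue)
    \<le> (\<integral>\<^sup>+x. ennreal (norm (indicator {a..b} x * \<bar>f x\<bar> powr p + indicator {a..b} x)) \<partial>lebesgue)"
    by (intro nn_integral_mono ennreal_leI) (auto simp: indicator_def max_def)
  also have "\<dots> < \<infinity>" using I by (simp add: integrable_iff_bounded)
  finally show ?thesis .
qed

theorem theorem3p12:
  fixes \<alpha> p q a b :: real and f g :: "real \<Rightarrow> real"
  assumes "a < b"
    and "0 < \<alpha>" and "\<alpha> < 1"
    and "p \<ge> 1" and "q \<ge> 1"
    and "1 / p + 1 / q \<le> 1 + \<alpha>"
    and "1 / p + 1 / q = 1 + \<alpha> \<longrightarrow> p \<noteq> 1 \<and> q \<noteq> 1"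
    and "f \<in> Lp_on p {a..b}" and "g \<in> Lp_on q {a..b}"
  shows "set_integrable lebesgue {a..b}
           (\<lambda>\<tau>. f \<tau> * dual_fun a b (left_frac_integral \<alpha> a g) \<tau>) \<and>
         set_integrable lebesgue {a..b}
           (\<lambda>\<tau>. left_frac_integral \<alpha> a f \<tau> * dual_fun a b g \<tau>) \<and>
         (LINT \<tau>:{a..b}|lebesgue. f \<tau> * dual_fun a b (left_frac_integral \<alpha> a g) \<tau>) =
         (LINT \<tau>:{a..b}|lebesgue. left_frac_integral \<alpha> a f \<tau> * dual_fun a b g \<tau>)"
proof -
  \<comment> \<open>For x and y in the interval, y - x never exceeds b - a, so the cut-off removes
    nothing there.\<close>
  define k where "k = trunc_kernel \<alpha> (b - a)"
  have k_meas [measurable]: "k \<in> borel_measurable borel" by (simp add: k_def)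
  have k_nn: "0 \<le> k z" for z by (simp add: k_def trunc_kernel_nonneg)
  define f0 where "f0 x = indicator {a..b} x * f x" for x
  define g1 where "g1 x = indicator {a..b} x * g x" for x
  \<comment> \<open>This is the dual of \<open>g\<close> extended by zero: the reflection maps the
    interval onto itself.\<close>
  define g0 where "g0 y = g1 ((a + b) + (-1) * y)" for y
  have f0_meas [measurable]: "f0 \<in> borel_measurable lebesgue"
    using assms by (simp add: Lp_on_def set_borel_measurable_def f0_def[abs_def])
  have g1_meas [measurable]: "g1 \<in> borel_measurable lebesgue"
    using assms by (simp add: Lp_on_def set_borel_measurable_def g1_def[abs_def])
  have refl: "(\<lambda>y. (a + b) + (-1) * y) \<in> lebesgue \<rightarrow>\<^sub>M lebesgue"
    using lebesgue_affine_measurable[of "\<lambda>_. -1" "a + b"] by simp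
  have g0_meas [measurable]: "g0 \<in> borel_measurable lebesgue"
    unfolding g0_def[abs_def] by (rule measurable_compose[OF refl g1_meas])

  define F where "F x = indicator {a..b} x * max 1 \<bar>f x\<bar>" for x
  define G1 where "G1 x = indicator {a..b} x * max 1 \<bar>g x\<bar>" for x
  define G where "G y = G1 ((a + b) + (-1) * y)" for y
  \<comment> \<open>The function \<open>f\<close> is known to be measurable only on the interval, so
    measurability of \<open>F\<close> is obtained through the zero extension
    \<open>f0\<close>.\<close>
  have F_eq: "F x = indicator {a..b} x * max 1 \<bar>f0 x\<bar>" for x
    by (simp add: F_def f0_def indicator_def)
  have G1_eq: "G1 x = indicator {a..b} x * max 1 \<bar>g1 x\<bar>" for x
    by (simp add: G1_def g1_def indicator_def)
  have F_meas [measurable]: "F \<in> borel_measurable lebesgue"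
    unfolding F_eq[abs_def]
    by (intro borel_measurable_times borel_measurable_max borel_measurable_abs
        borel_measurable_indicator) auto
  have G1_meas [measurable]: "G1 \<in> borel_measurable lebesgue"
    unfolding G1_eq[abs_def]
    by (intro borel_measurable_times borel_measurable_max borel_measurable_abs
        borel_measurable_indicator) auto
  have G_meas [measurable]: "G \<in> borel_measurable lebesgue"
    unfolding G_def[abs_def] by (rule measurable_compose[OF refl G1_meas])
  have Fp: "(\<integral>\<^sup>+x. ennreal (F x powr p) \<partial>lebesgue) < \<infinity>"
    unfolding F_def using assms by (intro Lp_on_powr_max_finite) auto
  have "(\<integral>\<^sup>+x. ennreal (G1 x powr q) \<partial>lebesgue) < \<infinity>"
    unfolding G1_def using assms by (intro Lp_on_powr_max_finite) auto
  also have "(\<integral>\<^sup>+x. ennreal (G1 x powr q) \<partial>lebesgue) = (\<integral>\<^sup>+x. ennreal (G x powr q) \<partial>lebesgue)"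
    unfolding G_def by (subst nn_integral_real_affine_lebesgue[where c = "-1" and t = "a + b"]) auto
  finally have Gq: "(\<integral>\<^sup>+x. ennreal (G x powr q) \<partial>lebesgue) < \<infinity>" .

  \<comment> \<open>The common integrand: up to the factor \<open>Gamma \<alpha>\<close>,
    integrating out y gives the left integrand of the claim and integrating out x gives the right
    one.\<close>
  define H where "H x y = f0 x * g0 y * k (y - x)" for x y
  have H_meas [measurable]: "case_prod H \<in> borel_measurable (lebesgue \<Otimes>\<^sub>M lebesgue)"
    unfolding H_def split_beta' by measurable
  have H_int: "integrable (lebesgue \<Otimes>\<^sub>M lebesgue) (case_prod H)"
  proof (rule integrableI_bounded)
    have "(\<integral>\<^sup>+p. ennreal (norm (case_prod H p)) \<partial>(lebesgue \<Otimes>\<^sub>M lebesgue))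
      = (\<integral>\<^sup>+x. \<integral>\<^sup>+y. ennreal (norm (H x y)) \<partial>lebesgue \<partial>lebesgue)"
      by (subst sigma_finite_measure.nn_integral_fst[OF sigma_finite_lebesgue, symmetric]) auto
    also have "\<dots> \<le> (\<integral>\<^sup>+x. \<integral>\<^sup>+y. ennreal (F x * G y * k (y - x)) \<partial>lebesgue \<partial>lebesgue)"
    proof (intro nn_integral_mono ennreal_leI)
      fix x y
      have "\<bar>f0 x\<bar> \<le> F x" "\<bar>g0 y\<bar> \<le> G y"
        by (auto simp: f0_def F_def g0_def g1_def G_def G1_def indicator_def)
      then have "\<bar>f0 x\<bar> * \<bar>g0 y\<bar> * k (y - x) \<le> F x * G y * k (y - x)"
        using k_nn by (intro mult_right_mono mult_mono) auto
      then show "norm (H x y) \<le> F x * G y * k (y - x)"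
        using k_nn by (simp add: H_def abs_mult)
    qed
    also have "\<dots> < \<infinity>"
      unfolding k_def using assms Fp Gq
      by (intro nn_integral_trunc_kernel_finite[of F G \<alpha> p q])
        (auto simp: F_def G_def G1_def indicator_def)
    finally show "(\<integral>\<^sup>+p. ennreal (norm (case_prod H p)) \<partial>(lebesgue \<Otimes>\<^sub>M lebesgue)) < \<infinity>" .
  qed measurable

  have Gam: "Gamma \<alpha> \<noteq> 0" using assms by (simp add: Gamma_real_pos less_imp_neq[symmetric])
  \<comment> \<open>This holds at every x, not just almost everywhere: where the fractional integral
    diverges, both sides take the default value 0.\<close>
  have X: "(\<integral>y. H x y \<partial>lebesgue) =
      Gamma \<alpha> * (indicator {a..b} x * (f x * dual_fun a b (left_frac_integral \<alpha> a g) x))" for x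
  proof (cases "x \<in> {a..b}")
    case True
    have "(\<integral>y. H x y \<partial>lebesgue) = f x * (\<integral>y. g0 y * k (y - x) \<partial>lebesgue)"
      using True by (simp add: H_def f0_def mult.assoc)
    also have "(\<integral>y. g0 y * k (y - x) \<partial>lebesgue)
        = (\<integral>y. g0 ((a + b) + (-1) * y) * k ((a + b) + (-1) * y - x) \<partial>lebesgue)"
      by (subst lebesgue_integral_real_affine[where c = "-1" and t = "a + b"]) auto
    \<comment> \<open>After y is replaced by a + b - y, the kernel argument is the distance to b - x
      + a, the upper limit of the fractional integral at the reflected point. At that endpoint both
      integrands vanish, since \<open>0 powr (\<alpha> - 1)\<close> is 0.\<close>
    also have "\<dots> = (LINT \<tau>:{a..b - x + a}|lebesgue. g \<tau> * (b - x + a - \<tau>) powr (\<alpha> - 1))"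
      unfolding set_lebesgue_integral_def using True
      by (intro Bochner_Integration.integral_cong)
        (auto simp: g0_def g1_def k_def trunc_kernel_def indicator_def algebra_simps)
    finally show ?thesis
      using True Gam by (simp add: dual_fun_def left_frac_integral_def)
  qed (simp add: H_def f0_def)
  have Y: "(\<integral>x. H x y \<partial>lebesgue) =
      Gamma \<alpha> * (indicator {a..b} y * (left_frac_integral \<alpha> a f y * dual_fun a b g y))" for y
  proof (cases "y \<in> {a..b}")
    case True
    have "(\<integral>x. H x y \<partial>lebesgue) = (\<integral>x. g0 y * (f0 x * k (y - x)) \<partial>lebesgue)"
      by (simp add: H_def mult_ac)
    also have "\<dots> = g0 y * (\<integral>x. f0 x * k (y - x) \<partial>lebesgue)" by simp
    also have "g0 y = dual_fun a b g y"
      using True by (simp add: g0_def g1_def dual_fun_def indicator_def algebra_simps)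
    also have "(\<integral>x. f0 x * k (y - x) \<partial>lebesgue)
        = (LINT \<tau>:{a..y}|lebesgue. f \<tau> * (y - \<tau>) powr (\<alpha> - 1))"
      unfolding set_lebesgue_integral_def using True
      by (intro Bochner_Integration.integral_cong)
        (auto simp: f0_def k_def trunc_kernel_def indicator_def)
    finally show ?thesis
      using True Gam by (simp add: left_frac_integral_def)
  next
    case False
    then have "g0 y = 0" by (auto simp: g0_def g1_def indicator_def)
    then show ?thesis using False by (simp add: H_def)
  qed
  \<comment> \<open>By \<open>X\<close> and \<open>Y\<close>, the integrability of the two partial
    integrals of \<open>H\<close> and the equality of its iterated integrals are the three claims
    multiplied by the nonzero factor \<open>Gamma \<alpha>\<close>.\<close>
  have "integrable lebesgue (\<lambda>x. \<integral>y. H x y \<partial>lebesgue)"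
    using lebesgue_pair.integrable_fst'[OF H_int] by simp
  moreover have "integrable lebesgue (\<lambda>y. \<integral>x. H x y \<partial>lebesgue)"
    by (rule lebesgue_pair.integrable_snd[OF H_int])
  moreover have "(\<integral>x. \<integral>y. H x y \<partial>lebesgue \<partial>lebesgue) = (\<integral>y. \<integral>x. H x y \<partial>lebesgue \<partial>lebesgue)"
    by (rule lebesgue_pair.Fubini_integral[OF H_int, symmetric])
  ultimately show ?thesis
    using Gam unfolding X Y by (simp add: set_integrable_def set_lebesgue_integral_def)
qed

end
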